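(* For all computations $M,N$ of $\lambda_{\copyright}$: (1) if $M (\to^{\mathsf s}_{\copyright})^* N$ then there is $L$ with $M (\to^{\mathsf s}_{\sigma\beta_c})^* L (\to^{\mathsf s}_{\iota})^* N$; (2) if $M \to_{\copyright}^* N$ then there are $L_1,L_2$ with $M (\to^{\mathsf s}_{\sigma\beta_c})^* L_1 (\to^{\neg\mathsf s}_{\sigma\beta_c})^* L_2 \to_{\iota}^* N$.
   Context: The computational core $\lambda_{\copyright}$ has values $V,W ::= x \mid \lambda x.M$ and computations $M,N,L ::= \,!V \mid VM$ ($x$ ranging over a countable set of variables, terms up to $\alpha$-renaming). Rules on computations: $\beta_c$: $(\lambda x.M)(!V) \mapsto M\{V/x\}$; $\mathsf{id}$: $(\lambda x.!x)M \mapsto M$; $\sigma$: $(\lambda y.N)((\lambda x.M)L) \mapsto (\lambda x.(\lambda y.N)M)L$ provided $x\notin \mathrm{fv}(N)$; $\iota$ is $\mathsf{id}$ minus $\beta_c$, i.e. $(\lambda x.!x)M\mapsto M$ where $M$ is not of the form $!V$; $\sigma\beta_c=\sigma\cup\beta_c$ and $\copyright=\beta_c\cup\mathsf{id}\cup\sigma$. Contexts: $C ::= [\,] \mid\, !(\lambda x.C) \mid VC \mid (\lambda x.C)M$; surface contexts $S ::= [\,]\mid VS\mid(\lambda x.S)M$. For a rule $\rho$: $\to_\rho$ is its closure under all contexts, $\to^{\mathsf s}_\rho$ its closure under surface contexts, $\to^{\neg\mathsf s}_\rho$ its closure under contexts that are not surface. $^*$ is reflexive–transitive closure. *)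

theory Defs
  imports Main
begin

text \<open>Terms up to alpha-renaming are represented by de Bruijn terms: \<open>Lam M\<close> binds index 0
  in \<open>M\<close>, and an index not bound by an enclosing \<open>Lam\<close> is a free variable. \<open>Ret V\<close> is the computation \<open>!V\<close>.\<close>

datatype val = Var nat | Lam computation
  and computation = Ret val | App val computation

text \<open>\<open>lift_comp k M\<close> increments every index of \<open>M\<close> that is at least \<open>k\<close>.\<close>

primrec lift_val :: "nat \<Rightarrow> val \<Rightarrow> val"
  and lift_comp :: "nat \<Rightarrow> computation \<Rightarrow> computation" where
  "lift_val k (Var i) = (if i < k then Var i else Var (Suc i))"
| "lift_val k (Lam M) = Lam (lift_comp (Suc k) M)"
| "lift_comp k (Ret V) = Ret (lift_val k V)"
| "lift_comp k (App V M) = App (lift_val k V) (lift_comp k M)"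

text \<open>Capture-avoiding substitution of a value for index \<open>k\<close>; since the binder of \<open>k\<close> disappears,
  the indices above \<open>k\<close> are decremented.\<close>

primrec subst_val :: "nat \<Rightarrow> val \<Rightarrow> val \<Rightarrow> val"
  and subst_comp :: "nat \<Rightarrow> val \<Rightarrow> computation \<Rightarrow> computation" where
  "subst_val k U (Var i) = (if i < k then Var i else if i = k then U else Var (i - 1))"
| "subst_val k U (Lam M) = Lam (subst_comp (Suc k) (lift_val 0 U) M)"
| "subst_comp k U (Ret V) = Ret (subst_val k U V)"
| "subst_comp k U (App V M) = App (subst_val k U V) (subst_comp k U M)"

definition beta_c :: "computation rel" where
  "beta_c = {(App (Lam M) (Ret V), subst_comp 0 V M) | M V. True}"

definition id_rule :: "computation rel" where
  "id_rule = {(App (Lam (Ret (Var 0))) M, M) | M. True}"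

text \<open>The proviso that the bound variable of \<open>Lam M\<close> is not free in \<open>N\<close> is realised by the lifting
  of \<open>Lam N\<close>, which is moved below that binder.\<close>

definition sigma :: "computation rel" where
  "sigma = {(App (Lam N) (App (Lam M) L),
             App (Lam (App (lift_val 0 (Lam N)) M)) L) | N M L. True}"

definition iota :: "computation rel" where
  "iota = {(App (Lam (Ret (Var 0))) M, M) | M. \<forall>V. M \<noteq> Ret V}"

definition sigma_beta_c :: "computation rel" where
  "sigma_beta_c = sigma \<union> beta_c"

definition copyright :: "computation rel" where
  "copyright = beta_c \<union> id_rule \<union> sigma"

text \<open>Contexts \<open>[]\<close>, \<open>!(\<lambda>x.C)\<close>, \<open>V C\<close> and \<open>(\<lambda>x.C) M\<close>. Plugging does not lift the plugged
  term, so the binders of the context may capture its free variables.\<close>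

datatype ctx =
    Hole
  | RetLam ctx
  | AppArg val ctx
  | AppLam ctx computation

primrec plug :: "ctx \<Rightarrow> computation \<Rightarrow> computation" where
  "plug Hole R = R"
| "plug (RetLam C) R = Ret (Lam (plug C R))"
| "plug (AppArg V C) R = App V (plug C R)"
| "plug (AppLam C M) R = App (Lam (plug C R)) M"

inductive surface :: "ctx \<Rightarrow> bool" where
  "surface Hole"
| "surface S \<Longrightarrow> surface (AppArg V S)"
| "surface S \<Longrightarrow> surface (AppLam S M)"

definition step :: "computation rel \<Rightarrow> computation rel" where
  "step \<rho> = {(plug C R, plug C R') | C R R'. (R, R') \<in> \<rho>}"

definition surface_step :: "computation rel \<Rightarrow> computation rel" where
  "surface_step \<rho> = {(plug C R, plug C R') | C R R'. surface C \<and> (R, R') \<in> \<rho>}"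

definition nonsurface_step :: "computation rel \<Rightarrow> computation rel" where
  "nonsurface_step \<rho> = {(plug C R, plug C R') | C R R'. \<not> surface C \<and> (R, R') \<in> \<rho>}"

end

theory Submission
  imports Defs
begin

text \<open>Postponement of \<open>\<iota>\<close>: a parallel \<open>\<iota>\<close>-reduction followed by one \<open>\<sigma>\<beta>\<^sub>c\<close>-step can be turned into
  \<open>\<sigma>\<beta>\<^sub>c\<close>-steps followed by one parallel \<open>\<iota>\<close>-reduction. Because \<open>\<iota>\<close> never exposes a returned value,
  it creates no \<open>\<beta>\<^sub>c\<close>-redex. It may create a \<open>\<sigma>\<close>-redex, by erasing an identity between two
  abstractions, but \<open>(\<lambda>y.N)(I M)\<close> reduces to \<open>(\<lambda>y.N) M\<close> by \<open>\<sigma>\<close> and \<open>\<beta>\<^sub>c\<close> alone.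

  Surface factorization of \<open>\<sigma>\<beta>\<^sub>c\<close> follows Kashima's method: a relation of standard reductions,
  which perform surface steps first and then reduce componentwise, absorbs any further
  \<open>\<sigma>\<beta>\<^sub>c\<close>-step on the right.\<close>

section \<open>Lifting and substitution\<close>

lemma lift_lift:
  "i \<le> k \<Longrightarrow> lift_val i (lift_val k V) = lift_val (Suc k) (lift_val i V)"
  "i \<le> k \<Longrightarrow> lift_comp i (lift_comp k M) = lift_comp (Suc k) (lift_comp i M)"
  by (induction V and M arbitrary: i k and i k) auto

lemma subst_lift:
  "subst_val k U (lift_val k V) = V"
  "subst_comp k U (lift_comp k M) = M"
  by (induction V and M arbitrary: k U and k U) auto

text \<open>Contracting a freshly lifted abstraction with its own bound variable as argument
  restores its body. This closes the detour in \<open>drop_identity\<close>.\<close>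

lemma subst_Var_lift_Suc:
  "subst_val k (Var k) (lift_val (Suc k) V) = V"
  "subst_comp k (Var k) (lift_comp (Suc k) M) = M"
  by (induction V and M arbitrary: k and k) auto

lemma lift_subst_ge:
  "i \<le> k \<Longrightarrow> lift_val k (subst_val i U V) = subst_val i (lift_val k U) (lift_val (Suc k) V)"
  "i \<le> k \<Longrightarrow> lift_comp k (subst_comp i U M) = subst_comp i (lift_val k U) (lift_comp (Suc k) M)"
  by (induction V and M arbitrary: i k U and i k U) (auto simp: lift_lift)

lemma lift_subst_le:
  "k \<le> i \<Longrightarrow> lift_val k (subst_val i U V) = subst_val (Suc i) (lift_val k U) (lift_val k V)"
  "k \<le> i \<Longrightarrow> lift_comp k (subst_comp i U M) = subst_comp (Suc i) (lift_val k U) (lift_comp k M)"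
  by (induction V and M arbitrary: i k U and i k U) (auto simp: lift_lift)

lemma subst_subst:
  "i \<le> k \<Longrightarrow> subst_val k U (subst_val i W V)
     = subst_val i (subst_val k U W) (subst_val (Suc k) (lift_val i U) V)"
  "i \<le> k \<Longrightarrow> subst_comp k U (subst_comp i W M)
     = subst_comp i (subst_val k U W) (subst_comp (Suc k) (lift_val i U) M)"
  by (induction V and M arbitrary: i k U W and i k U W)
     (auto simp: subst_lift lift_lift lift_subst_le)


section \<open>Compatible closures\<close>

text \<open>The flag tells whether reduction under \<open>Ret\<close> is allowed: \<open>True\<close> gives the closure under all
  contexts, \<open>False\<close> the closure under surface contexts.\<close>

inductive_set compat :: "bool \<Rightarrow> computation rel \<Rightarrow> computation rel" for b \<rho> where
  root: "(M, N) \<in> \<rho> \<Longrightarrow> (M, N) \<in> compat b \<rho>"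
| ret: "b \<Longrightarrow> (M, N) \<in> compat b \<rho> \<Longrightarrow> (Ret (Lam M), Ret (Lam N)) \<in> compat b \<rho>"
| arg: "(M, N) \<in> compat b \<rho> \<Longrightarrow> (App V M, App V N) \<in> compat b \<rho>"
| lam: "(M, N) \<in> compat b \<rho> \<Longrightarrow> (App (Lam M) L, App (Lam N) L) \<in> compat b \<rho>"

lemma surface_simps [simp]:
  "surface Hole" "\<not> surface (RetLam C)"
  "surface (AppArg V C) \<longleftrightarrow> surface C" "surface (AppLam C M) \<longleftrightarrow> surface C"
  by (auto intro: surface.intros elim: surface.cases)

lemma compat_True: "compat True \<rho> = step \<rho>"
proof (intro equalityI subrelI)
  fix M N assume "(M, N) \<in> compat True \<rho>"
  then show "(M, N) \<in> step \<rho>"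
    unfolding step_def by induction (auto, (metis plug.simps)+)
next
  fix M N assume "(M, N) \<in> step \<rho>"
  then obtain C R R' where MN: "M = plug C R" "N = plug C R'" and "(R, R') \<in> \<rho>"
    by (auto simp: step_def)
  then show "(M, N) \<in> compat True \<rho>"
    unfolding MN by (induction C) (auto intro: compat.intros)
qed

lemma compat_False: "compat False \<rho> = surface_step \<rho>"
proof (intro equalityI subrelI)
  fix M N assume "(M, N) \<in> compat False \<rho>"
  then show "(M, N) \<in> surface_step \<rho>"
    unfolding surface_step_def by induction (auto, (metis plug.simps surface_simps)+)
next
  fix M N assume "(M, N) \<in> surface_step \<rho>"
  then obtain C R R' where MN: "M = plug C R" "N = plug C R'" and "surface C" "(R, R') \<in> \<rho>"
    by (auto simp: surface_step_def)
  then show "(M, N) \<in> compat False \<rho>"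
    unfolding MN by (induction C) (auto intro: compat.intros)
qed

lemma rtrancl_map:
  assumes "\<And>x y. (x, y) \<in> r \<Longrightarrow> (f x, f y) \<in> s" and "(x, y) \<in> r\<^sup>*"
  shows "(f x, f y) \<in> s\<^sup>*"
  using assms(2) by induction (auto intro: rtrancl_into_rtrancl assms(1))

lemma compat_rtrancl_arg: "(M, N) \<in> (compat b \<rho>)\<^sup>* \<Longrightarrow> (App V M, App V N) \<in> (compat b \<rho>)\<^sup>*"
  by (rule rtrancl_map[where f = "App V"]) (rule compat.arg)

lemma compat_rtrancl_lam:
  "(M, N) \<in> (compat b \<rho>)\<^sup>* \<Longrightarrow> (App (Lam M) L, App (Lam N) L) \<in> (compat b \<rho>)\<^sup>*"
  by (rule rtrancl_map[where f = "\<lambda>M. App (Lam M) L"]) (rule compat.lam)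

lemma compat_rtrancl_ret:
  "b \<Longrightarrow> (M, N) \<in> (compat b \<rho>)\<^sup>* \<Longrightarrow> (Ret (Lam M), Ret (Lam N)) \<in> (compat b \<rho>)\<^sup>*"
  by (rule rtrancl_map[where f = "\<lambda>M. Ret (Lam M)"]) (rule compat.ret)

lemma sigma_beta_c_cases [consumes 1, case_names beta sigma]:
  assumes "(M, N) \<in> sigma_beta_c"
  obtains P V where "M = App (Lam P) (Ret V)" "N = subst_comp 0 V P"
  | P Q L where "M = App (Lam P) (App (Lam Q) L)"
      "N = App (Lam (App (lift_val 0 (Lam P)) Q)) L"
  using assms unfolding sigma_beta_c_def beta_c_def sigma_def by blast

lemma beta_in_compat: "(App (Lam P) (Ret V), subst_comp 0 V P) \<in> compat b sigma_beta_c"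
  by (rule compat.root) (auto simp: sigma_beta_c_def beta_c_def)

lemma sigma_in_compat:
  "(App (Lam P) (App (Lam Q) L), App (Lam (App (lift_val 0 (Lam P)) Q)) L) \<in> compat b sigma_beta_c"
  by (rule compat.root) (auto simp: sigma_beta_c_def sigma_def)

lemma compat_lift:
  "(M, N) \<in> compat b sigma_beta_c \<Longrightarrow> (lift_comp k M, lift_comp k N) \<in> compat b sigma_beta_c"
proof (induction arbitrary: k rule: compat.induct)
  case (root M N)
  then show ?case
  proof (cases rule: sigma_beta_c_cases)
    case (beta P V)
    then show ?thesis by (simp add: lift_subst_ge beta_in_compat)
  next
    case (sigma P Q L)
    then show ?thesis
      using sigma_in_compat[of "lift_comp (Suc k) P"] by (simp add: lift_lift)
  qed
qed (auto intro: compat.intros)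

lemma compat_subst:
  "(M, N) \<in> compat b sigma_beta_c \<Longrightarrow> (subst_comp k U M, subst_comp k U N) \<in> compat b sigma_beta_c"
proof (induction arbitrary: k U rule: compat.induct)
  case (root M N)
  then show ?case
  proof (cases rule: sigma_beta_c_cases)
    case (beta P V)
    then show ?thesis by (simp add: subst_subst beta_in_compat)
  next
    case (sigma P Q L)
    then show ?thesis
      using sigma_in_compat[of "subst_comp (Suc k) (lift_val 0 U) P"]
      by (simp add: lift_subst_le lift_lift)
  qed
qed (auto intro: compat.intros)


section \<open>Postponement of iota\<close>

abbreviation is_ret :: "computation \<Rightarrow> bool" where
  "is_ret M \<equiv> \<exists>V. M = Ret V"

text \<open>Parallel \<open>iota\<close>. With \<open>b\<close> false, the side condition of
  \<open>Ret\<close> freezes returned values, so only surface positions reduce. The condition on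
  \<open>M\<close> in \<open>Iota\<close> separates \<open>iota\<close> from
  \<open>id_rule\<close>.\<close>

inductive par_val :: "bool \<Rightarrow> val \<Rightarrow> val \<Rightarrow> bool"
  and par_comp :: "bool \<Rightarrow> computation \<Rightarrow> computation \<Rightarrow> bool" for b where
  Var: "par_val b (Var i) (Var i)"
| Lam: "par_comp b M N \<Longrightarrow> par_val b (Lam M) (Lam N)"
| Ret: "par_val b V W \<Longrightarrow> b \<or> V = W \<Longrightarrow> par_comp b (Ret V) (Ret W)"
| App: "par_val b V W \<Longrightarrow> par_comp b M N \<Longrightarrow> par_comp b (App V M) (App W N)"
| Iota: "par_comp b M N \<Longrightarrow> \<not> is_ret M \<Longrightarrow> par_comp b (App (Lam (Ret (Var 0))) M) N"

inductive_cases par_val_LamE: "par_val b V (Lam N)"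

lemma par_refl: "par_val b V V" "par_comp b M M"
  by (induction V and M) (auto intro: par_val_par_comp.intros)

text \<open>Only \<open>Iota\<close> could change the head constructor to \<open>Ret\<close>, and
  its side condition passes to \<open>N\<close> by induction. Hence no \<open>beta_c\<close> redex
  is created.\<close>

lemma par_is_ret: "par_comp b M N \<Longrightarrow> is_ret N \<longleftrightarrow> is_ret M"
  by (induction rule: par_val_par_comp.inducts(2)[where ?P1.0 = "\<lambda>_ _. True"]) auto

lemma par_RetE:
  assumes "par_comp b M (Ret W)"
  obtains V where "M = Ret V" "par_val b V W" "b \<or> V = W"
  using assms par_is_ret[OF assms] by (auto elim: par_comp.cases)

lemma is_ret_lift: "is_ret (lift_comp k M) \<longleftrightarrow> is_ret M"
  by (cases M) auto

lemma is_ret_subst: "is_ret (subst_comp k U M) \<longleftrightarrow> is_ret M"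
  by (cases M) auto

lemma par_lift:
  "par_val b V W \<Longrightarrow> par_val b (lift_val k V) (lift_val k W)"
  "par_comp b M N \<Longrightarrow> par_comp b (lift_comp k M) (lift_comp k N)"
proof (induction arbitrary: k and k rule: par_val_par_comp.inducts)
  case (Iota M N)
  then show ?case
    using par_val_par_comp.Iota[of b "lift_comp k M"] by (simp add: is_ret_lift)
qed (auto intro: par_val_par_comp.intros)

text \<open>A substituted value may land under \<open>Ret\<close>, where for \<open>b\<close> false
  only equal values are related; hence \<open>b \<or> X = Y\<close>. The argument \<open>Ret\<close>
  of a \<open>beta_c\<close> redex supplies exactly this condition.\<close>

lemma par_subst:
  "par_val b V W \<Longrightarrow> par_val b X Y \<Longrightarrow> b \<or> X = Y \<Longrightarrow> par_val b (subst_val k X V) (subst_val k Y W)"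
  "par_comp b M N \<Longrightarrow> par_val b X Y \<Longrightarrow> b \<or> X = Y \<Longrightarrow> par_comp b (subst_comp k X M) (subst_comp k Y N)"
proof (induction arbitrary: k X Y and k X Y rule: par_val_par_comp.inducts)
  case (Lam M N)
  have "par_comp b (subst_comp (Suc k) (lift_val 0 X) M) (subst_comp (Suc k) (lift_val 0 Y) N)"
    using Lam.prems by (intro Lam.IH par_lift) auto
  then show ?case by (simp add: par_val_par_comp.Lam)
next
  case (Iota M N)
  then show ?case
    using par_val_par_comp.Iota[of b "subst_comp k X M"] by (simp add: is_ret_subst)
qed (auto intro: par_val_par_comp.intros)

text \<open>\<open>sigma\<close> moves \<open>Lam P\<close> under the binder of the identity, next
  to \<open>Ret (Var 0)\<close>; there \<open>beta_c\<close> contracts it to \<open>P\<close>. Both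
  positions are surface, so either flag works.\<close>

lemma drop_identity:
  "(App (Lam P) (App (Lam (Ret (Var 0))) M), App (Lam P) M) \<in> (compat b sigma_beta_c)\<^sup>*"
proof -
  have "(App (lift_val 0 (Lam P)) (Ret (Var 0)), P) \<in> compat b sigma_beta_c"
    using beta_in_compat[of "lift_comp 1 P" "Var 0"] by (simp add: subst_Var_lift_Suc)
  then have "(App (Lam (App (lift_val 0 (Lam P)) (Ret (Var 0)))) M, App (Lam P) M)
      \<in> compat b sigma_beta_c"
    by (rule compat.lam)
  with sigma_in_compat show ?thesis
    by (meson r_into_rtrancl rtrancl.rtrancl_into_rtrancl)
qed

text \<open>\<open>M\<close> is a stack of identities above an application headed by an abstraction.
  The outer \<open>Lam P\<close> lets \<open>drop_identity\<close> remove them one at a time, which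
  uncovers the \<open>sigma\<close> redex.\<close>

lemma par_sigma_redex:
  assumes "par_comp b M (App (Lam Q') L')"
  shows "\<exists>Q L. (App (Lam P) M, App (Lam P) (App (Lam Q) L)) \<in> (compat b sigma_beta_c)\<^sup>*
    \<and> par_comp b Q Q' \<and> par_comp b L L'"
  using assms
proof (induction M "App (Lam Q') L'"
    rule: par_val_par_comp.inducts(2)[where ?P1.0 = "\<lambda>_ _. True"])
  case (App V M)
  then show ?case by (auto elim!: par_val_LamE)
next
  case (Iota M)
  then show ?case by (meson drop_identity rtrancl_trans)
qed auto

lemma par_sigma_beta_c:
  assumes V: "par_val b V V'" and M: "par_comp b M M'" and "(App V' M', N) \<in> sigma_beta_c"
  shows "\<exists>P. (App V M, P) \<in> (compat b sigma_beta_c)\<^sup>* \<and> par_comp b P N"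
  using assms(3)
proof (cases rule: sigma_beta_c_cases)
  case (beta P' W')
  then obtain P W where VM: "V = Lam P" "par_comp b P P'" "M = Ret W" "par_val b W W'" "b \<or> W = W'"
    using V M by (auto elim!: par_val_LamE par_RetE)
  with beta(2) show ?thesis
    using par_subst(2) beta_in_compat by (metis r_into_rtrancl)
next
  case (sigma P' Q' L')
  then obtain P where P: "V = Lam P" "par_comp b P P'"
    using V by (auto elim!: par_val_LamE)
  obtain Q L where VM: "(App V M, App (Lam P) (App (Lam Q) L)) \<in> (compat b sigma_beta_c)\<^sup>*"
    and QL: "par_comp b Q Q'" "par_comp b L L'"
    using par_sigma_redex M sigma(1) P(1) by blast
  from VM sigma_in_compat
  have "(App V M, App (Lam (App (lift_val 0 (Lam P)) Q)) L) \<in> (compat b sigma_beta_c)\<^sup>*"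
    by (rule rtrancl.rtrancl_into_rtrancl)
  moreover have "par_comp b (App (Lam (App (lift_val 0 (Lam P)) Q)) L) N"
    unfolding sigma(2) using P QL by (intro par_val_par_comp.intros par_lift)
  ultimately show ?thesis by blast
qed

text \<open>Values themselves do not step, so the clause for values speaks of a step in the body of
  an abstraction. A step at the root is the case of \<open>par_sigma_beta_c\<close>; all others pass
  to a component.\<close>

lemma par_postpone_step:
  shows "par_val b V (Lam L) \<Longrightarrow> (L, N) \<in> compat b sigma_beta_c \<Longrightarrow>
      \<exists>M P. V = Lam M \<and> (M, P) \<in> (compat b sigma_beta_c)\<^sup>* \<and> par_comp b P N"
    and "par_comp b M K \<Longrightarrow> (K, N) \<in> compat b sigma_beta_c \<Longrightarrow>
      \<exists>P. (M, P) \<in> (compat b sigma_beta_c)\<^sup>* \<and> par_comp b P N"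
proof (induction V "Lam L" and M K arbitrary: L N and N rule: par_val_par_comp.inducts)
  case (Ret V W)
  from Ret.prems obtain L N' where L: "b" "W = Lam L" "N = Ret (Lam N')" "(L, N') \<in> compat b sigma_beta_c"
    by cases (auto elim: sigma_beta_c_cases)
  then obtain M P where "V = Lam M" "(M, P) \<in> (compat b sigma_beta_c)\<^sup>*" "par_comp b P N'"
    using Ret.hyps by blast
  with L show ?case
    by (meson compat_rtrancl_ret par_val_par_comp.Ret par_val_par_comp.Lam)
next
  case (App V W M K)
  from App.prems show ?case
  proof cases
    case root
    then show ?thesis using par_sigma_beta_c App.hyps by blast
  next
    case (arg K')
    then show ?thesis
      using App.hyps by (meson compat_rtrancl_arg par_val_par_comp.App)
  next
    case (lam L L')
    then obtain Q P where "V = Lam Q" "(Q, P) \<in> (compat b sigma_beta_c)\<^sup>*" "par_comp b P L'"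
      using App.hyps(2) by blast
    with lam App.hyps(3) show ?thesis
      by (meson compat_rtrancl_lam par_val_par_comp.App par_val_par_comp.Lam)
  qed
next
  case (Iota M K)
  let ?I = "Lam (Ret (Var 0))"
  from Iota obtain P where P: "(M, P) \<in> (compat b sigma_beta_c)\<^sup>*" "par_comp b P N"
    by blast
  have MP: "(App ?I M, App ?I P) \<in> (compat b sigma_beta_c)\<^sup>*"
    using P(1) by (rule compat_rtrancl_arg)
  show ?case
  \<comment> \<open>The reduction from \<open>M\<close> to \<open>P\<close> may have produced a
    returned value, so that \<open>Iota\<close> no longer applies; but then the identity is itself a
    \<open>beta_c\<close> redex.\<close>
  proof (cases "is_ret P")
    case True
    then have "(App ?I P, P) \<in> compat b sigma_beta_c"
      using beta_in_compat[of "Ret (Var 0)"] by auto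
    with MP P(2) show ?thesis by (meson rtrancl.rtrancl_into_rtrancl)
  next
    case False
    with MP P(2) show ?thesis by (meson par_val_par_comp.Iota)
  qed
qed auto

lemma compat_iota_par: "(M, N) \<in> compat b iota \<Longrightarrow> par_comp b M N"
proof (induction rule: compat.induct)
  case (root M N)
  then show ?case by (auto simp: iota_def intro: par_val_par_comp.Iota par_refl)
qed (auto intro: par_val_par_comp.intros par_refl)

text \<open>Parallel steps are sequentialized: head before argument, and an identity is erased
  before its argument reduces, while the side condition on that argument is known to hold.\<close>

lemma par_compat_iota:
  "par_val b V W \<Longrightarrow>
    (\<exists>i. V = Var i \<and> W = V) \<or> (\<exists>M N. V = Lam M \<and> W = Lam N \<and> (M, N) \<in> (compat b iota)\<^sup>*)"
  "par_comp b M N \<Longrightarrow> (M, N) \<in> (compat b iota)\<^sup>*"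
proof (induction rule: par_val_par_comp.inducts)
  case (Ret V W)
  then show ?case by (auto intro: compat_rtrancl_ret)
next
  case (App V W M N)
  from App.IH have "(App V M, App W M) \<in> (compat b iota)\<^sup>*"
    by (auto intro: compat_rtrancl_lam)
  also from App.IH have "(App W M, App W N) \<in> (compat b iota)\<^sup>*"
    by (auto intro: compat_rtrancl_arg)
  finally show ?case .
next
  case (Iota M N)
  then have "(App (Lam (Ret (Var 0))) M, M) \<in> compat b iota"
    by (intro compat.root) (auto simp: iota_def)
  with Iota.IH show ?case by (meson converse_rtrancl_into_rtrancl)
qed auto

lemma par_postpone:
  assumes "(L, N) \<in> (compat b sigma_beta_c)\<^sup>*" "par_comp b M L"
  shows "\<exists>P. (M, P) \<in> (compat b sigma_beta_c)\<^sup>* \<and> par_comp b P N"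
  using assms
proof (induction rule: rtrancl_induct)
  case (step K N)
  then show ?case by (meson par_postpone_step(2) rtrancl_trans)
qed auto

text \<open>An \<open>id_rule\<close> step on a returned value is a \<open>beta_c\<close> step, and
  any other is an \<open>iota\<close> step.\<close>

lemma compat_copyright: "compat b copyright \<subseteq> compat b sigma_beta_c \<union> compat b iota"
proof (rule subrelI)
  fix M N assume "(M, N) \<in> compat b copyright"
  then show "(M, N) \<in> compat b sigma_beta_c \<union> compat b iota"
  proof induction
    case (root M N)
    show ?case
    proof (cases "(M, N) \<in> id_rule")
      case True
      then have M: "M = App (Lam (Ret (Var 0))) N" by (auto simp: id_rule_def)
      show ?thesis
      proof (cases "is_ret N")
        case True
        then show ?thesis using M beta_in_compat[of "Ret (Var 0)"] by auto
      next
        case False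
        then show ?thesis using M by (auto simp: iota_def intro: compat.root)
      qed
    next
      case False
      with root show ?thesis by (auto simp: copyright_def sigma_beta_c_def intro: compat.root)
    qed
  qed (auto intro: compat.intros)
qed

text \<open>Induction from the left: a leading \<open>iota\<close> step, read as a parallel one, is
  carried past the whole \<open>sigma_beta_c\<close> sequence by
  \<open>par_postpone\<close>.\<close>

theorem iota_postponement:
  assumes "(M, N) \<in> (compat b copyright)\<^sup>*"
  shows "\<exists>L. (M, L) \<in> (compat b sigma_beta_c)\<^sup>* \<and> (L, N) \<in> (compat b iota)\<^sup>*"
  using assms
proof (induction rule: converse_rtrancl_induct)
  case (step M K)
  then obtain L where L: "(K, L) \<in> (compat b sigma_beta_c)\<^sup>*" "(L, N) \<in> (compat b iota)\<^sup>*"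
    by blast
  consider "(M, K) \<in> compat b sigma_beta_c" | "(M, K) \<in> compat b iota"
    using step.hyps compat_copyright by blast
  then show ?case
  proof cases
    case 1
    with L show ?thesis by (meson converse_rtrancl_into_rtrancl)
  next
    case 2
    with L(1) obtain P where "(M, P) \<in> (compat b sigma_beta_c)\<^sup>*" "par_comp b P L"
      using par_postpone compat_iota_par by blast
    with L(2) show ?thesis by (meson par_compat_iota(2) rtrancl_trans)
  qed
qed auto


section \<open>Surface factorization\<close>

abbreviation surface_red :: "computation rel" where
  "surface_red \<equiv> (compat False sigma_beta_c)\<^sup>*"

text \<open>Surface steps first expose the outermost constructor of the target; the components are
  then standard in turn. Values have no surface steps of their own, so \<open>std_val\<close> is
  purely structural.\<close>

inductive std_val :: "val \<Rightarrow> val \<Rightarrow> bool"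
  and std_comp :: "computation \<Rightarrow> computation \<Rightarrow> bool" where
  Var: "std_val (Var i) (Var i)"
| Lam: "std_comp M N \<Longrightarrow> std_val (Lam M) (Lam N)"
| Ret: "(M, Ret V) \<in> surface_red \<Longrightarrow> std_val V W \<Longrightarrow> std_comp M (Ret W)"
| App: "(M, App V L) \<in> surface_red \<Longrightarrow> std_val V V' \<Longrightarrow> std_comp L L' \<Longrightarrow> std_comp M (App V' L')"

inductive_cases std_val_LamE: "std_val V (Lam N)"
inductive_cases std_RetE: "std_comp M (Ret V)"
inductive_cases std_AppE: "std_comp M (App V L)"

lemma std_refl: "std_val V V" "std_comp M M"
  by (induction V and M) (auto intro: std_val_std_comp.intros)

lemma surface_red_std: "(M, L) \<in> surface_red \<Longrightarrow> std_comp L N \<Longrightarrow> std_comp M N"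
  by (erule std_comp.cases) (auto intro: std_val_std_comp.intros rtrancl_trans)

lemma std_lift:
  "std_val V W \<Longrightarrow> std_val (lift_val k V) (lift_val k W)"
  "std_comp M N \<Longrightarrow> std_comp (lift_comp k M) (lift_comp k N)"
proof (induction arbitrary: k and k rule: std_val_std_comp.inducts)
  case (Ret M V W)
  have "(lift_comp k M, lift_comp k (Ret V)) \<in> surface_red"
    using compat_lift Ret.hyps(1) by (rule rtrancl_map)
  with Ret.IH show ?case by (auto intro: std_val_std_comp.intros)
next
  case (App M V L V' L')
  have "(lift_comp k M, lift_comp k (App V L)) \<in> surface_red"
    using compat_lift App.hyps(1) by (rule rtrancl_map)
  with App.IH show ?case by (auto intro: std_val_std_comp.intros)
qed (auto intro: std_val_std_comp.intros)

text \<open>The initial surface reductions survive substitution of the same \<open>X\<close> by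
  \<open>compat_subst\<close>; the passage from \<open>X\<close> to \<open>Y\<close> happens only at
  the variables.\<close>

lemma std_subst:
  "std_val V W \<Longrightarrow> std_val X Y \<Longrightarrow> std_val (subst_val k X V) (subst_val k Y W)"
  "std_comp M N \<Longrightarrow> std_val X Y \<Longrightarrow> std_comp (subst_comp k X M) (subst_comp k Y N)"
proof (induction arbitrary: k X Y and k X Y rule: std_val_std_comp.inducts)
  case (Lam M N)
  then show ?case by (simp add: std_val_std_comp.Lam std_lift)
next
  case (Ret M V W)
  have "(subst_comp k X M, subst_comp k X (Ret V)) \<in> surface_red"
    using compat_subst Ret.hyps(1) by (rule rtrancl_map)
  with Ret show ?case by (auto intro: std_val_std_comp.intros)
next
  case (App M V L V' L')
  have "(subst_comp k X M, subst_comp k X (App V L)) \<in> surface_red"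
    using compat_subst App.hyps(1) by (rule rtrancl_map)
  with App show ?case by (auto intro: std_val_std_comp.intros)
qed (auto intro: std_val_std_comp.intros)

text \<open>Argument position is surface, so the surface steps that expose the argument extend those
  that expose the outer application. \<open>M\<close> thus reaches a redex of the same shape by
  surface steps and can fire it as one more.\<close>

lemma std_sigma_beta_c:
  assumes "(L, N) \<in> sigma_beta_c" "std_comp M L"
  shows "std_comp M N"
  using assms(1)
proof (cases rule: sigma_beta_c_cases)
  case (beta P V)
  with assms(2) obtain P0 M0 V0
    where M: "(M, App (Lam P0) M0) \<in> surface_red" "std_comp P0 P"
      and M0: "(M0, Ret V0) \<in> surface_red" "std_val V0 V"
    by (auto elim!: std_AppE std_RetE std_val_LamE)
  from M(1) compat_rtrancl_arg[OF M0(1)] have "(M, App (Lam P0) (Ret V0)) \<in> surface_red"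
    by (rule rtrancl_trans)
  then have "(M, subst_comp 0 V0 P0) \<in> surface_red"
    using beta_in_compat by (rule rtrancl.rtrancl_into_rtrancl)
  then show ?thesis
    using std_subst(2)[OF M(2) M0(2)] beta(2) surface_red_std by blast
next
  case (sigma P Q K)
  with assms(2) obtain P0 M0 Q0 K0
    where M: "(M, App (Lam P0) M0) \<in> surface_red" "std_comp P0 P"
      and M0: "(M0, App (Lam Q0) K0) \<in> surface_red" "std_comp Q0 Q" "std_comp K0 K"
    by (auto elim!: std_AppE std_val_LamE)
  from M(1) compat_rtrancl_arg[OF M0(1)] have "(M, App (Lam P0) (App (Lam Q0) K0)) \<in> surface_red"
    by (rule rtrancl_trans)
  then have "(M, App (Lam (App (lift_val 0 (Lam P0)) Q0)) K0) \<in> surface_red"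
    using sigma_in_compat by (rule rtrancl.rtrancl_into_rtrancl)
  then show ?thesis
    unfolding sigma(2) using M(2) M0(2,3)
    by (blast intro: std_val_std_comp.intros std_lift rtrancl_refl)
qed

lemma std_step: "(L, N) \<in> compat True sigma_beta_c \<Longrightarrow> std_comp M L \<Longrightarrow> std_comp M N"
proof (induction arbitrary: M rule: compat.induct)
  case (root L N)
  then show ?case by (rule std_sigma_beta_c)
qed (auto elim!: std_AppE std_RetE std_val_LamE intro: std_val_std_comp.intros)

lemma steps_std: "(M, N) \<in> (step sigma_beta_c)\<^sup>* \<Longrightarrow> std_comp M N"
  by (induction rule: rtrancl_induct) (auto intro: std_refl std_step simp flip: compat_True)

lemma nonsurface_step_ret: "(M, N) \<in> step \<rho> \<Longrightarrow> (Ret (Lam M), Ret (Lam N)) \<in> nonsurface_step \<rho>"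
  unfolding step_def nonsurface_step_def by (clarsimp, metis plug.simps(2) surface_simps(2))

lemma nonsurface_step_arg: "(M, N) \<in> nonsurface_step \<rho> \<Longrightarrow> (App V M, App V N) \<in> nonsurface_step \<rho>"
  unfolding nonsurface_step_def by (clarsimp, metis plug.simps(3) surface_simps(3))

lemma nonsurface_step_lam:
  "(M, N) \<in> nonsurface_step \<rho> \<Longrightarrow> (App (Lam M) L, App (Lam N) L) \<in> nonsurface_step \<rho>"
  unfolding nonsurface_step_def by (clarsimp, metis plug.simps(4) surface_simps(4))

text \<open>The bodies of abstractions are factorized separately, because the surface steps of a
  body stay surface in head position but become non-surface under \<open>Ret\<close>.\<close>

lemma std_factor:
  "std_val V W \<Longrightarrow> (\<exists>i. V = Var i \<and> W = V) \<or> (\<exists>M L N. V = Lam M \<and> W = Lam N \<and>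
      (M, L) \<in> surface_red \<and> (L, N) \<in> (nonsurface_step sigma_beta_c)\<^sup>*)"
  "std_comp M N \<Longrightarrow> \<exists>L. (M, L) \<in> surface_red \<and> (L, N) \<in> (nonsurface_step sigma_beta_c)\<^sup>*"
proof (induction rule: std_val_std_comp.inducts)
  case (Ret M V W)
  \<comment> \<open>Under \<open>Ret\<close> every step of the body is non-surface, so both halves
    of its factorization are merged into ordinary steps.\<close>
  have "surface_red \<subseteq> (step sigma_beta_c)\<^sup>*"
    unfolding compat_False by (rule rtrancl_mono) (auto simp: surface_step_def step_def)
  moreover have "(nonsurface_step sigma_beta_c)\<^sup>* \<subseteq> (step sigma_beta_c)\<^sup>*"
    by (rule rtrancl_mono) (auto simp: nonsurface_step_def step_def)
  ultimately have "V = W \<or> (\<exists>P Q. V = Lam P \<and> W = Lam Q \<and> (P, Q) \<in> (step sigma_beta_c)\<^sup>*)"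
    using Ret.IH by (metis rtrancl_trans subsetD)
  then have "(Ret V, Ret W) \<in> (nonsurface_step sigma_beta_c)\<^sup>*"
    using rtrancl_map[where f = "\<lambda>M. Ret (Lam M)", OF nonsurface_step_ret] by auto
  with Ret.hyps(1) show ?case by blast
next
  case (App M V L V' L')
  \<comment> \<open>\<open>V1\<close> is \<open>V\<close> after the surface half of its body's
    reduction. The argument \<open>K\<close> is left open because the two halves are used with
    different arguments, \<open>L\<close> and \<open>L1\<close>.\<close>
  from App.IH(1) obtain V1
    where V1: "\<And>K. (App V K, App V1 K) \<in> surface_red"
      "\<And>K. (App V1 K, App V' K) \<in> (nonsurface_step sigma_beta_c)\<^sup>*"
    using compat_rtrancl_lam rtrancl_map[where f = "\<lambda>M. App (Lam M) _", OF nonsurface_step_lam]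
    by (metis rtrancl_refl)
  from App.IH(2) obtain L1
    where L1: "(L, L1) \<in> surface_red" "(L1, L') \<in> (nonsurface_step sigma_beta_c)\<^sup>*"
    by blast
  note App.hyps(1)
  also note V1(1)
  also note compat_rtrancl_arg[OF L1(1)]
  finally have "(M, App V1 L1) \<in> surface_red" .
  moreover have "(App V1 L1, App V' L') \<in> (nonsurface_step sigma_beta_c)\<^sup>*"
    using V1(2) rtrancl_map[where f = "App V'", OF nonsurface_step_arg L1(2)]
    by (rule rtrancl_trans)
  ultimately show ?case by blast
qed auto

theorem mainTheorem4:
  fixes M N :: computation
  shows
    "((M, N) \<in> (surface_step copyright)\<^sup>* \<longrightarrow>
        (\<exists>L. (M, L) \<in> (surface_step sigma_beta_c)\<^sup>* \<and> (L, N) \<in> (surface_step iota)\<^sup>*)) \<and>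
     ((M, N) \<in> (step copyright)\<^sup>* \<longrightarrow>
        (\<exists>L1 L2. (M, L1) \<in> (surface_step sigma_beta_c)\<^sup>* \<and>
                 (L1, L2) \<in> (nonsurface_step sigma_beta_c)\<^sup>* \<and>
                 (L2, N) \<in> (step iota)\<^sup>*))"
proof (intro conjI impI)
  assume "(M, N) \<in> (surface_step copyright)\<^sup>*"
  then show "\<exists>L. (M, L) \<in> (surface_step sigma_beta_c)\<^sup>* \<and> (L, N) \<in> (surface_step iota)\<^sup>*"
    using iota_postponement[of _ _ False] by (simp add: compat_False)
next
  assume "(M, N) \<in> (step copyright)\<^sup>*"
  \<comment> \<open>Postponement in all contexts isolates the \<open>iota\<close> tail; the
    remaining \<open>sigma_beta_c\<close> sequence is then made standard and split.\<close>
  then obtain L2 where "(M, L2) \<in> (step sigma_beta_c)\<^sup>*" and L2: "(L2, N) \<in> (step iota)\<^sup>*"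
    using iota_postponement[of _ _ True] by (auto simp: compat_True)
  then obtain L1 where "(M, L1) \<in> (surface_step sigma_beta_c)\<^sup>*"
    "(L1, L2) \<in> (nonsurface_step sigma_beta_c)\<^sup>*"
    using std_factor(2)[OF steps_std] by (auto simp: compat_False)
  with L2 show "\<exists>L1 L2. (M, L1) \<in> (surface_step sigma_beta_c)\<^sup>* \<and>
      (L1, L2) \<in> (nonsurface_step sigma_beta_c)\<^sup>* \<and> (L2, N) \<in> (step iota)\<^sup>*"
    by blast
qed

end
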